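(* Let $k\geq 2$ and let $D_1, D_2, \ldots, D_k$ be a collection of pairwise vertex disjoint Hamiltonian digraphs, let $n_i=|V(D_i)|$ for each $i\in\{1,\ldots,k\}$, and let $D$ be a strongly connected digraph in $\oplus_{i=1}^k D_i$. Then at least one of the following assertions holds: (i) $D$ is vertex-pancyclic; (ii) $D$ is pancyclic; or (iii) $D$ is Hamiltonian and it contains a cycle of length $l$ for each integer $l$ with $3\leq l\leq \max\left\{\left(\sum_{i\in S} n_i\right) + 1 \colon S\subset\{1,\ldots,k\},\ |S|=k-1\right\}$.
   Context: Digraphs are finite, without loops or parallel arcs; a pair of opposite arcs $(u,v),(v,u)$ is allowed and forms a cycle of length 2. "Cycle" means directed cycle (no repeated vertices), and its length is its number of arcs. A digraph is Hamiltonian if it has a cycle containing all its vertices. A digraph is strong (strongly connected) if for each pair of different vertices $u,v$ there exist a directed path from $u$ to $v$ and one from $v$ to $u$. A digraph $D$ of order $N\geq 3$ is pancyclic if it contains a cycle of length $l$ for each $l\in\{3,\ldots,N\}$. It is vertex-pancyclic if for each vertex $v$ and each $l\in\{3,\ldots,N\}$ it contains a cycle of length $l$ passing through $v$. Generalized sum: for pairwise vertex disjoint digraphs $D_1,\ldots,D_k$, the set $\oplus_{i=1}^k D_i$ consists of all digraphs $D$ such that (1) $V(D)=\bigcup_{i=1}^k V(D_i)$; (2) for each $i$ the subdigraph of $D$ induced by $V(D_i)$ is $D_i$; (3) for each pair of vertices $u,v$ belonging to different summands, exactly one of $(u,v)$, $(v,u)$ is an arc of $D$ (directions being arbitrary).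 *)

theory Defs
  imports "Graph_Theory.Graph_Theory" "HOL-Library.Disjoint_Sets"
begin

(* A cycle p in the sense of pre_digraph.cycle is a closed arc walk, so length p is its number of
   arcs and its vertices are the tails of its arcs.  In a loopless digraph every cycle has length
   at least 2, and a pair of opposite arcs forms a cycle of length 2. *)

definition cycle_verts :: "('a, 'b) pre_digraph \<Rightarrow> 'b awalk \<Rightarrow> 'a set" where
  "cycle_verts G p = tail G ` set p"

definition has_cycle_of_length :: "('a, 'b) pre_digraph \<Rightarrow> nat \<Rightarrow> bool" where
  "has_cycle_of_length G l \<longleftrightarrow> (\<exists>p. pre_digraph.cycle G p \<and> length p = l)"

definition hamiltonian :: "('a, 'b) pre_digraph \<Rightarrow> bool" where
  "hamiltonian G \<longleftrightarrow> (\<exists>p. pre_digraph.cycle G p \<and> verts G \<subseteq> cycle_verts G p)"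

definition pancyclic :: "('a, 'b) pre_digraph \<Rightarrow> bool" where
  "pancyclic G \<longleftrightarrow> 3 \<le> card (verts G) \<and>
     (\<forall>l \<in> {3..card (verts G)}. has_cycle_of_length G l)"

definition vertex_pancyclic :: "('a, 'b) pre_digraph \<Rightarrow> bool" where
  "vertex_pancyclic G \<longleftrightarrow> 3 \<le> card (verts G) \<and>
     (\<forall>v \<in> verts G. \<forall>l \<in> {3..card (verts G)}.
        \<exists>p. pre_digraph.cycle G p \<and> length p = l \<and> v \<in> cycle_verts G p)"

(* The set of all generalized sums of Ds 1, ..., Ds k.  It is only meaningful for summands with
   pairwise disjoint vertex sets. *)

definition generalized_sum ::
    "nat \<Rightarrow> (nat \<Rightarrow> 'a pair_pre_digraph) \<Rightarrow> 'a pair_pre_digraph set" where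
  "generalized_sum k Ds = {D. pair_digraph D \<and>
     pverts D = (\<Union>i \<in> {1..k}. pverts (Ds i)) \<and>
     (\<forall>i \<in> {1..k}. induced_subgraph (with_proj (Ds i)) (with_proj D)) \<and>
     (\<forall>i \<in> {1..k}. \<forall>j \<in> {1..k}. i \<noteq> j \<longrightarrow>
        (\<forall>u \<in> pverts (Ds i). \<forall>v \<in> pverts (Ds j).
           ((u, v) \<in> parcs D) \<noteq> ((v, u) \<in> parcs D)))}"

end

theory Submission
  imports Defs
begin

text \<open>
  Assertion (iii) always holds.

  For two disjoint cycles $x$ and $y$ with exactly one arc between any $x_i$ and $y_j$ and arcs in
  both directions, let $R(i,j)$ mean $x_i \to y_j$. If the cycles cannot be merged by exchanging one
  arc of each, then $R(i+1,j) = R(i,j+1)$, and this symmetry yields a Hamiltonian cycle consisting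
  of two segments of each cycle. If there is no cycle of length $l \le n+1$, where $n$ is the length
  of $x$, then $R$ is $(l-2)$-periodic in $i$ and $R(i+1,j+1) = R(i,j)$, and this symmetry yields a
  cycle of length $l$ that visits $y$ in two vertices.

  For many summands, partition a vertex set into as few Hamiltonian parts as possible. Two parts
  with arcs in both directions, or three parts dominating each other cyclically, could be merged,
  so the parts form a transitive tournament. For the vertex set of a strong digraph this leaves a
  single part. For all summands but one, with Hamiltonian cycle $y$ on the omitted summand, either
  there is a single part and the two-cycle case applies, or there are a first part $X$ and a last
  part $Z$, and a shortest segment of $y$ leading from an out-neighbour of $Z$ to an in-neighbour
  of $X$ closes the paths from $X$ to $Z$, which have all possible numbers of vertices.
\<close>

section \<open>Cycles as vertex lists and as periodic enumerations\<close>

text \<open>The closing vertex is not repeated, so the length of the list is the number of arcs. A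
  single vertex qualifies only if it carries a loop.\<close>

definition vcycle :: "('a \<Rightarrow> 'a \<Rightarrow> bool) \<Rightarrow> 'a list \<Rightarrow> bool" where
  "vcycle E xs \<longleftrightarrow> xs \<noteq> [] \<and> distinct xs \<and> successively E xs \<and> E (last xs) (hd xs)"

text \<open>Condition (3) of the generalized sum for two vertex sets; it fails as soon as they
  intersect.\<close>

definition joined :: "('a \<Rightarrow> 'a \<Rightarrow> bool) \<Rightarrow> 'a set \<Rightarrow> 'a set \<Rightarrow> bool" where
  "joined E A B \<longleftrightarrow> (\<forall>a\<in>A. \<forall>b\<in>B. E a b \<noteq> E b a)"

text \<open>The enumeration is defined on all natural numbers, so that a segment of the cycle is an
  interval of indices even when it passes the starting point.\<close>

definition cyclic_enum :: "('a \<Rightarrow> 'a \<Rightarrow> bool) \<Rightarrow> nat \<Rightarrow> (nat \<Rightarrow> 'a) \<Rightarrow> bool" where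
  "cyclic_enum E n x \<longleftrightarrow>
     0 < n \<and> (\<forall>i. x (i + n) = x i) \<and> inj_on x {..<n} \<and> (\<forall>i. E (x i) (x (Suc i)))"

lemma joined_sym: "joined E A B \<Longrightarrow> joined E B A"
  unfolding joined_def by blast

lemma joined_Union_iff: "joined E (\<Union>F) B \<longleftrightarrow> (\<forall>A\<in>F. joined E A B)"
  unfolding joined_def by blast

lemma periodic_mult:
  assumes "\<And>i. x (i + n) = x i"
  shows "x (i + k * n) = x (i :: nat)"
proof (induction k)
  case (Suc k)
  have "x (i + Suc k * n) = x ((i + k * n) + n)" by (simp add: algebra_simps)
  then show ?case using assms Suc by simp
qed simp

text \<open>From \<open>i + d\<close>, another \<open>n - 1\<close> applications of the implication
  lead to \<open>i + d * n\<close>, which the period identifies with \<open>i\<close>. A one-way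
  implication around a cycle is thus an equivalence.\<close>

lemma periodic_stable_iff:
  fixes Q :: "nat \<Rightarrow> bool"
  assumes per: "\<And>i. Q (i + n) = Q i" and "0 < n" and step: "\<And>i. Q i \<Longrightarrow> Q (i + d)"
  shows "Q (i + d) = Q i"
proof
  assume Q: "Q (i + d)"
  have it: "Q (i + d + k * d)" for k
  proof (induction k)
    case (Suc k)
    then show ?case using step[of "i + d + k * d"] by (simp add: algebra_simps)
  qed (simp add: Q)
  have eq: "i + d + (n - 1) * d = i + d * n"
    using \<open>0 < n\<close> by (cases n) (auto simp: algebra_simps)
  then show "Q i" using it[of "n - 1"] periodic_mult[of Q n i d, OF per] unfolding eq by blast
qed (rule step)

lemma cyclic_enum_mod:
  assumes "cyclic_enum E n x"
  shows "x (i mod n) = x i"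
  using periodic_mult[of x n "i mod n" "i div n"] assms
  by (simp add: cyclic_enum_def)

lemma cyclic_enum_eq_iff:
  assumes "cyclic_enum E n x"
  shows "x i = x j \<longleftrightarrow> i mod n = j mod n"
proof
  assume "x i = x j"
  then have "x (i mod n) = x (j mod n)" using cyclic_enum_mod[OF assms] by simp
  moreover have "inj_on x {..<n}" "0 < n" using assms by (auto simp: cyclic_enum_def)
  ultimately show "i mod n = j mod n" by (auto dest!: inj_onD)
qed (metis cyclic_enum_mod[OF assms])

lemma range_cyclic_enum:
  assumes "cyclic_enum E n x"
  shows "range x = x ` {a..<a + n}"
proof -
  have n: "0 < n" using assms by (simp add: cyclic_enum_def)
  have "\<exists>j\<in>{a..<a + n}. x i = x j" for i
  proof
    \<comment> \<open>Modulo \<open>n\<close> the term \<open>a * (n - 1)\<close> stands for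
      \<open>- a\<close>, so \<open>?j\<close> is the index of the window that is congruent to
      \<open>i\<close>.\<close>
    let ?j = "a + (i + a * (n - 1)) mod n"
    show "?j \<in> {a..<a + n}" using n by simp
    have "?j mod n = (a + (i + a * (n - 1))) mod n" by (simp add: mod_add_right_eq)
    also have "a + (i + a * (n - 1)) = i + a * n" using n by (cases n) auto
    finally show "x i = x ?j" by (subst cyclic_enum_eq_iff[OF assms]) simp
  qed
  then show ?thesis by blast
qed

lemma set_map_cyclic_enum:
  "cyclic_enum E n x \<Longrightarrow> set (map x [a..<a + n]) = range x"
  by (simp add: range_cyclic_enum[symmetric])

lemma distinct_cyclic_enum:
  assumes "cyclic_enum E n x" and "b \<le> a + n"
  shows "distinct (map x [a..<b])"
proof -
  have "inj_on x {a..<b}"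
  proof (rule linorder_inj_onI)
    fix i j assume ij: "i < j" "i \<in> {a..<b}" "j \<in> {a..<b}"
    show "x i \<noteq> x j"
    proof
      assume "x i = x j"
      then have "i mod n = j mod n" using cyclic_enum_eq_iff[OF assms(1)] by simp
      then have "n dvd j - i" using ij by (metis less_imp_le mod_eq_dvd_iff_nat)
      then have "n \<le> j - i" using ij by (intro dvd_imp_le) auto
      then show False using ij assms(2) by auto
    qed
  qed auto
  then show ?thesis by (simp add: distinct_map)
qed

lemma successively_cyclic_enum:
  assumes "cyclic_enum E n x"
  shows "successively E (map x [a..<b])"
  using assms by (simp add: successively_conv_nth cyclic_enum_def)

lemma last_map_upt: "a < b \<Longrightarrow> last (map x [a..<b]) = x (b - 1)"
  by (simp add: last_map)

lemma hd_map_upt: "a < b \<Longrightarrow> hd (map x [a..<b]) = x a"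
  by (simp add: hd_map)

lemma vcycle_cyclic_enum:
  assumes "cyclic_enum E n x"
  shows "vcycle E (map x [a..<a + n])"
proof -
  have n: "0 < n" using assms by (simp add: cyclic_enum_def)
  have "E (x (a + n - 1)) (x (Suc (a + n - 1)))" using assms unfolding cyclic_enum_def by blast
  moreover have "Suc (a + n - 1) = a + n" using n by simp
  then have "x (Suc (a + n - 1)) = x a" using assms by (simp add: cyclic_enum_def)
  ultimately show ?thesis
    using n distinct_cyclic_enum[OF assms, of "a + n" a] successively_cyclic_enum[OF assms, of a "a + n"]
    by (simp add: vcycle_def last_map_upt hd_map_upt del: successively_map)
qed

lemma vcycle_imp_cyclic_enum:
  assumes "vcycle E xs"
  shows "cyclic_enum E (length xs) (\<lambda>i. xs ! (i mod length xs))"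
proof -
  let ?n = "length xs"
  have n: "0 < ?n" using assms by (simp add: vcycle_def)
  have "E (xs ! (i mod ?n)) (xs ! (Suc i mod ?n))" for i
  proof (cases "Suc (i mod ?n) = ?n")
    case True
    then have "Suc i mod ?n = 0" by (simp add: mod_Suc)
    moreover have "i mod ?n = ?n - 1" using True by simp
    ultimately show ?thesis
      using assms n by (auto simp: vcycle_def last_conv_nth hd_conv_nth)
  next
    case False
    then have "Suc i mod ?n = Suc (i mod ?n)" by (simp add: mod_Suc)
    moreover have "Suc (i mod ?n) < ?n" using False n by (meson Suc_lessI mod_less_divisor)
    ultimately show ?thesis
      using assms by (simp add: vcycle_def successively_conv_nth)
  qed
  then show ?thesis
    using assms n by (auto simp: cyclic_enum_def vcycle_def inj_on_def nth_eq_iff_index_eq)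
qed

lemma obtain_cyclic_enum:
  assumes "vcycle E xs"
  obtains x where "cyclic_enum E (length xs) x" and "range x = set xs"
proof
  show enum: "cyclic_enum E (length xs) (\<lambda>i. xs ! (i mod length xs))"
    by (rule vcycle_imp_cyclic_enum[OF assms])
  show "range (\<lambda>i. xs ! (i mod length xs)) = set xs"
    unfolding range_cyclic_enum[OF enum, of 0] by (auto simp: set_conv_nth image_iff) 
qed

lemma vcycle_rotate_hd:
  assumes "vcycle E xs" and "v \<in> set xs"
  obtains ys where "vcycle E ys" "set ys = set xs" "length ys = length xs" "hd ys = v"
proof -
  obtain x where x: "cyclic_enum E (length xs) x" "range x = set xs"
    using obtain_cyclic_enum[OF assms(1)] .
  obtain a where "v = x a" using x assms(2) by blast
  show thesis
  proof
    show "vcycle E (map x [a..<a + length xs])" by (rule vcycle_cyclic_enum[OF x(1)])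
    show "set (map x [a..<a + length xs]) = set xs"
      unfolding set_map_cyclic_enum[OF x(1)] by (rule x(2))
    show "hd (map x [a..<a + length xs]) = v"
      using x(1) \<open>v = x a\<close> by (subst hd_map_upt) (auto simp: cyclic_enum_def)
  qed simp
qed

lemma vcycle_rotate_last:
  assumes "vcycle E xs" and "v \<in> set xs"
  obtains ys where "vcycle E ys" "set ys = set xs" "length ys = length xs" "last ys = v"
proof -
  obtain x where x: "cyclic_enum E (length xs) x" "range x = set xs"
    using obtain_cyclic_enum[OF assms(1)] .
  obtain a where "v = x a" using x assms(2) by blast
  show thesis
  proof
    show "vcycle E (map x [Suc a..<Suc a + length xs])" by (rule vcycle_cyclic_enum[OF x(1)])
    show "set (map x [Suc a..<Suc a + length xs]) = set xs"
      unfolding set_map_cyclic_enum[OF x(1)] by (rule x(2))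
    show "last (map x [Suc a..<Suc a + length xs]) = v"
      using x(1) \<open>v = x a\<close> by (subst last_map_upt) (auto simp: cyclic_enum_def)
  qed (simp del: upt_Suc)
qed

text \<open>A discrete intermediate value argument: without such a switch, failure at
  \<open>a\<close> would propagate to \<open>b\<close>.\<close>

lemma first_change:
  assumes "\<not> P a" and "P b" and "a \<le> (b :: nat)"
  obtains h where "a \<le> h" "h < b" "\<not> P h" "P (Suc h)"
proof (rule ccontr)
  assume *: "\<not> thesis"
  have "\<not> P b" using assms(3)
    by (induction rule: dec_induct) (use * that assms(1) in auto)
  with assms(2) show False by blast
qed

lemma constant_if_Suc_eq:
  assumes "\<And>i :: nat. Q (Suc i) = Q i"
  shows "Q i = Q 0"
  by (induction i) (simp_all add: assms)

section \<open>Two cycles\<close>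

context
  fixes E :: "'a \<Rightarrow> 'a \<Rightarrow> bool" and n m :: nat and x y :: "nat \<Rightarrow> 'a"
  assumes x: "cyclic_enum E n x" and y: "cyclic_enum E m y"
    and n: "2 \<le> n" and m: "2 \<le> m"
    and disj: "range x \<inter> range y = {}"
    and join: "joined E (range x) (range y)"
    and xy: "\<exists>i j. E (x i) (y j)" and yx: "\<exists>i j. E (y j) (x i)"
begin

private lemma reverse_arc_iff: "E (y j) (x i) \<longleftrightarrow> \<not> E (x i) (y j)"
  using join unfolding joined_def by blast

private lemma shifts: "x (i + n) = x i" "y (j + m) = y j"
  using x y by (auto simp: cyclic_enum_def)

private lemma shift_mult: "x (i + k * n) = x i" "y (j + k * m) = y j"
  using shifts periodic_mult by metis+

private lemma ne: "x i \<noteq> y j" "y j \<noteq> x i"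
  using disj by (auto simp: disjoint_iff)

text \<open>A constant relation would send all arcs between the cycles in one direction, contrary to
  \<open>xy\<close> or \<open>yx\<close>.\<close>

private lemma not_constant:
  assumes "\<And>i j. E (x i) (y j) = E (x 0) (y 0)"
  shows False
  using assms xy yx reverse_arc_iff by metis

lemma merge_two_cycles: "\<exists>zs. vcycle E zs \<and> set zs = range x \<union> range y"
proof (cases "\<exists>i j. E (x i) (y (Suc j)) \<and> E (y j) (x (Suc i))")
  case True
  then obtain i j where ij: "E (x i) (y (Suc j))" "E (y j) (x (Suc i))" by blast
  \<comment> \<open>The arcs leaving \<open>x i\<close> and \<open>y j\<close> in their cycles are
    deleted; the remaining paths end at \<open>x i\<close> and \<open>y j\<close>, and the two arcs
    \<open>ij\<close> connect them crosswise.\<close>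
  let ?zs = "map x [Suc i..<Suc i + n] @ map y [Suc j..<Suc j + m]"
  have "vcycle E ?zs"
    unfolding vcycle_def
    using ij n m shifts ne distinct_cyclic_enum[OF x, of "Suc i + n" "Suc i"]
      distinct_cyclic_enum[OF y, of "Suc j + m" "Suc j"]
      successively_cyclic_enum[OF x, of "Suc i" "Suc i + n"]
      successively_cyclic_enum[OF y, of "Suc j" "Suc j + m"]
    by (auto simp: successively_append_iff last_map_upt hd_map_upt
        simp del: successively_map upt_Suc map_append)
  moreover have "set ?zs = range x \<union> range y"
    by (simp only: set_append set_map_cyclic_enum[OF x] set_map_cyclic_enum[OF y])
  ultimately show ?thesis by blast
next
  case False
  txt \<open>The implication from right to left, iterated around both cycles, returns to its start.\<close>
  have anti: "E (x (Suc i)) (y j) = E (x i) (y (Suc j))" for i j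
  proof -
    \<comment> \<open>Modulo \<open>m\<close> the term \<open>t * (m - 1)\<close> stands for
      \<open>- t\<close>, so \<open>Q\<close> follows an antidiagonal: the index of \<open>x\<close>
      rises while that of \<open>y\<close> falls. Both return after \<open>n * m\<close>
      steps.\<close>
    define Q where "Q t = E (x (i + t)) (y (Suc j + t * (m - 1)))" for t
    have "Q (0 + 1) = Q 0"
    proof (rule periodic_stable_iff)
      fix t
      have "i + (t + n * m) = (i + t) + m * n"
        "Suc j + (t + n * m) * (m - 1) = (Suc j + t * (m - 1)) + (n * (m - 1)) * m"
        by (simp_all add: algebra_simps)
      then show "Q (t + n * m) = Q t" unfolding Q_def by (simp only: shift_mult)
    next
      fix t assume "Q t"
      moreover have "Suc j + t * (m - 1) + m = Suc (Suc j + (t + 1) * (m - 1))"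
        using m by (cases m) auto
      ultimately have "E (x (i + t)) (y (Suc (Suc j + (t + 1) * (m - 1))))"
        unfolding Q_def by (metis shifts(2))
      then show "Q (t + 1)"
        using False reverse_arc_iff unfolding Q_def by auto
    qed (use n m in simp)
    moreover have "Suc j + (m - 1) = j + m" using m by simp
    ultimately show ?thesis by (simp add: Q_def shifts)
  qed
  \<comment> \<open>Otherwise every row of the relation would be constant, and by
    \<open>anti\<close> all rows would agree.\<close>
  obtain i j where ij: "E (x i) (y j)" "\<not> E (x i) (y (Suc j))"
  proof (rule ccontr)
    assume *: "\<not> thesis"
    have row: "E (x i) (y (Suc j)) = E (x i) (y j)" for i j
      using periodic_stable_iff[of "\<lambda>j. E (x i) (y j)" m 1 j] m * that by (auto simp: shifts)
    have "E (x i) (y j) = E (x i) (y 0)" for i j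
      using constant_if_Suc_eq[of "\<lambda>j. E (x i) (y j)", OF row] .
    moreover have "E (x i) (y 0) = E (x 0) (y 0)" for i
      by (rule constant_if_Suc_eq[of "\<lambda>i. E (x i) (y 0)"]) (simp add: anti row)
    ultimately show False using not_constant by blast
  qed
  \<comment> \<open>Since \<open>y (j + m)\<close> is \<open>y j\<close>, the out-neighbours of
    \<open>x i\<close> must resume somewhere after the gap at \<open>Suc j\<close>; \<open>h\<close>
    is a last index of such a gap.\<close>
  obtain h where h: "Suc j \<le> h" "h < j + m" "\<not> E (x i) (y h)" "E (x i) (y (Suc h))"
    using first_change[of "\<lambda>j. E (x i) (y j)" "Suc j" "j + m"] ij m by (auto simp: shifts)
  \<comment> \<open>The cycle \<open>y\<close> is cut before \<open>j\<close> and before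
    \<open>h\<close>, and \<open>x\<close> on both sides of \<open>x (Suc i)\<close>. By
    \<open>anti\<close>, the arcs at \<open>x (Suc i)\<close> come from the switch at
    \<open>h\<close>, and the arc from \<open>y (j + m - 1)\<close> to
    \<open>x (Suc (Suc i))\<close> from the switch at \<open>j\<close>.\<close>
  let ?zs = "x (Suc i) # map y [h..<j + m] @ map x [Suc (Suc i)..<Suc i + n] @ map y [j..<h]"
  have ys: "map y [j..<h] @ map y [h..<j + m] = map y [j..<j + m]"
    using h upt_add_eq_append[of j h "j + m - h"] by (simp flip: map_append)
  have xs: "x (Suc i) # map x [Suc (Suc i)..<Suc i + n] = map x [Suc i..<Suc i + n]"
    using n by (simp add: upt_conv_Cons)
  have "distinct (map y [j..<h] @ map y [h..<j + m])"
    unfolding ys by (rule distinct_cyclic_enum[OF y]) simp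
  moreover have "distinct (x (Suc i) # map x [Suc (Suc i)..<Suc i + n])"
    unfolding xs by (rule distinct_cyclic_enum[OF x]) simp
  ultimately have "distinct ?zs" using ne by (auto simp del: upt_Suc)
  moreover have "E (x (Suc i)) (y h)" using anti h by simp
  moreover have "E (y (j + m - 1)) (x (Suc (Suc i)))"
    using m ij(2) anti[of "Suc i" "j + m - 1"] anti[of i "j + m"] shifts(2)[of "Suc j"]
    by (simp add: reverse_arc_iff)
  moreover have "E (x (i + n)) (y j)" using ij by (simp add: shifts)
  moreover have "E (y (h - 1)) (x (Suc i))" 
    using h anti[of i "h - 1"] by (simp add: reverse_arc_iff)
  ultimately have "vcycle E ?zs"
    unfolding vcycle_def
    using h n m successively_cyclic_enum[OF x] successively_cyclic_enum[OF y]
    by (auto simp: successively_append_iff successively_Cons last_map_upt hd_map_upt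
        simp del: successively_map upt_Suc map_append)
  moreover have "set ?zs = set (x (Suc i) # map x [Suc (Suc i)..<Suc i + n]) \<union>
      set (map y [j..<h] @ map y [h..<j + m])"
    by (simp only: set_append list.set) blast
  then have "set ?zs = range x \<union> range y"
    by (simp only: xs ys set_map_cyclic_enum[OF x] set_map_cyclic_enum[OF y])
  ultimately show ?thesis by blast
qed

text \<open>The candidates consist of \<open>l - 1\<close> vertices of \<open>x\<close> and one of
  \<open>y\<close>, or of \<open>l - 2\<close> vertices of \<open>x\<close> and two of
  \<open>y\<close>. Excluding the first kind and those of the second kind whose vertices of
  \<open>y\<close> are adjacent in the cycle forces so much symmetry that another cycle of the
  second kind exists.\<close>

lemma short_cycles_of_two_cycles:
  assumes l: "3 \<le> l" "l \<le> n + 1"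
  shows "\<exists>zs. vcycle E zs \<and> length zs = l"
proof (rule ccontr)
  assume none: "\<nexists>zs. vcycle E zs \<and> length zs = l"
  define d where "d = l - 2"
  have d: "l = d + 2" "1 \<le> d" "Suc d \<le> n" using l by (auto simp: d_def)
  \<comment> \<open>Otherwise \<open>y j\<close> would close the path of \<open>d + 1\<close>
    vertices from \<open>x i\<close> to \<open>x (i + d)\<close>. The bound
    \<open>Suc d \<le> n\<close> keeps these vertices distinct.\<close>
  have "\<not> E (x (i + d)) (y j)" if "\<not> E (x i) (y j)" for i j
  proof
    assume "E (x (i + d)) (y j)"
    then have "vcycle E (map x [i..<i + Suc d] @ [y j])"
      unfolding vcycle_def
      using that d ne successively_cyclic_enum[OF x] distinct_cyclic_enum[OF x]
      by (auto simp: successively_append_iff last_map_upt hd_map_upt reverse_arc_iff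
        simp del: successively_map upt_Suc map_append)
    moreover have "length (map x [i..<i + Suc d] @ [y j]) = l" using d by simp
    ultimately show False using none by blast
  qed
  then have per: "E (x (i + d)) (y j) = E (x i) (y j)" for i j
    using periodic_stable_iff[of "\<lambda>i. \<not> E (x i) (y j)" n d i] n by (auto simp: shifts)
  txt \<open>By periodicity an arc $x_i \to y_j$ also gives a path of $d$ vertices of $x$ that ends at an
    in-neighbour of $y_j$ and starts at $x_{i+1}$; it would be closed by $y_j, y_{j+1}$.\<close>
  have diag1: "E (x (Suc i)) (y (Suc j))" if "E (x i) (y j)" for i j
  proof (rule ccontr)
    assume "\<not> E (x (Suc i)) (y (Suc j))"
    moreover have "E (y j) (y (Suc j))" using y by (simp add: cyclic_enum_def)
    moreover have "y j \<noteq> y (Suc j)"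
      using distinct_cyclic_enum[OF y, of "j + 2" j] m by simp
    moreover have "E (x (i + d)) (y j)" using that per by simp
    ultimately have "vcycle E (map x [Suc i..<Suc i + d] @ [y j, y (Suc j)])"
      unfolding vcycle_def
      using d ne successively_cyclic_enum[OF x] distinct_cyclic_enum[OF x]
      by (auto simp: successively_append_iff last_map_upt hd_map_upt reverse_arc_iff
        simp del: successively_map upt_Suc map_append)
    moreover have "length (map x [Suc i..<Suc i + d] @ [y j, y (Suc j)]) = l" using d by simp
    ultimately show False using none by blast
  qed
  have diag: "E (x (Suc i)) (y (Suc j)) = E (x i) (y j)" for i j
  proof -
    define Q where "Q t = E (x (i + t)) (y (j + t))" for t
    have "Q (0 + 1) = Q 0"
    proof (rule periodic_stable_iff)
      fix t
      have "i + (t + n * m) = (i + t) + m * n" "j + (t + n * m) = (j + t) + n * m" by auto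
      then show "Q (t + n * m) = Q t" unfolding Q_def by (simp only: shift_mult)
    qed (use n m diag1 Q_def in auto)
    then show ?thesis by (simp add: Q_def)
  qed
  \<comment> \<open>Otherwise the relation would not depend on the index of \<open>x\<close>, and by
    \<open>diag\<close> it would be constant.\<close>
  obtain i j where ij: "E (x i) (y j)" "\<not> E (x (Suc i)) (y j)"
  proof (rule ccontr)
    assume *: "\<not> thesis"
    have col: "E (x (Suc i)) (y j) = E (x i) (y j)" for i j
      using periodic_stable_iff[of "\<lambda>i. E (x i) (y j)" n 1 i] n * that by (auto simp: shifts)
    have "E (x i) (y j) = E (x 0) (y j)" for i j
      using constant_if_Suc_eq[of "\<lambda>i. E (x i) (y j)", OF col] .
    moreover have "E (x 0) (y j) = E (x 0) (y 0)" for j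
      by (rule constant_if_Suc_eq[of "\<lambda>j. E (x 0) (y j)"]) (metis col diag)
    ultimately show False using not_constant by blast
  qed
  \<comment> \<open>For \<open>d = 1\<close> the periodicity \<open>per\<close> contradicts the
    change between \<open>i\<close> and \<open>Suc i\<close>.\<close>
  have "d \<noteq> 1" using ij per[of i j] by auto
  then have d2: "2 \<le> d" using d by simp
  \<comment> \<open>The path from \<open>x (Suc i)\<close> to \<open>x (i + d)\<close> has its first
    arc replaced by a detour through \<open>y (Suc j)\<close>, which exists because
    \<open>diag\<close> moves the change \<open>ij\<close> one step on. Then \<open>y j\<close>
    closes the cycle, by \<open>per\<close> and \<open>ij\<close>.\<close>
  let ?zs = "x (Suc i) # y (Suc j) # map x [Suc (Suc i)..<Suc i + d] @ [y j]"
  have "y j \<noteq> y (Suc j)"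
    using distinct_cyclic_enum[OF y, of "j + 2" j] m by simp
  moreover have "x (Suc i) # map x [Suc (Suc i)..<Suc i + d] = map x [Suc i..<Suc i + d]"
    using d2 by (simp add: upt_conv_Cons)
  then have "distinct (x (Suc i) # map x [Suc (Suc i)..<Suc i + d])"
    using distinct_cyclic_enum[OF x, of "Suc i + d" "Suc i"] d by simp
  ultimately have "distinct ?zs" using ne by (auto simp del: upt_Suc)
  moreover have "E (x (i + d)) (y j)" using ij per by simp
  moreover have "E (x (Suc i)) (y (Suc j))" "\<not> E (x (Suc (Suc i))) (y (Suc j))"
    using ij diag by auto
  ultimately have "vcycle E ?zs"
    unfolding vcycle_def
    using ij d2 successively_cyclic_enum[OF x]
    by (auto simp: successively_append_iff successively_Cons last_map_upt hd_map_upt reverse_arc_iff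
        simp del: successively_map upt_Suc map_append)
  moreover have "length ?zs = l" using d d2 by simp
  ultimately show False using none by blast
qed

end

section \<open>Partitions into Hamiltonian parts\<close>

definition completely_dominates :: "('a \<Rightarrow> 'a \<Rightarrow> bool) \<Rightarrow> 'a set \<Rightarrow> 'a set \<Rightarrow> bool" where
  "completely_dominates E A B \<longleftrightarrow> (\<forall>a\<in>A. \<forall>b\<in>B. E a b)"

text \<open>The invariant that survives merging parts. No part is empty, because a
  \<open>vcycle\<close> is nonempty.\<close>

definition ham_partition :: "('a \<Rightarrow> 'a \<Rightarrow> bool) \<Rightarrow> 'a set set \<Rightarrow> 'a set \<Rightarrow> bool" where
  "ham_partition E F U \<longleftrightarrow> finite F \<and> \<Union>F = U \<and>
     (\<forall>A\<in>F. \<exists>xs. vcycle E xs \<and> set xs = A) \<and>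
     (\<forall>A\<in>F. \<forall>B\<in>F. A \<noteq> B \<longrightarrow> A \<inter> B = {} \<and> joined E A B)"

text \<open>Strong connectivity in terms of cuts: some arc leaves each nonempty proper
  subset.\<close>

definition strong_on :: "('a \<Rightarrow> 'a \<Rightarrow> bool) \<Rightarrow> 'a set \<Rightarrow> bool" where
  "strong_on E V \<longleftrightarrow> (\<forall>W\<subseteq>V. W \<noteq> {} \<longrightarrow> W \<noteq> V \<longrightarrow> (\<exists>a\<in>W. \<exists>b\<in>V - W. E a b))"

lemma completely_dominates_asym:
  "joined E A B \<Longrightarrow> completely_dominates E A B \<Longrightarrow> a \<in> A \<Longrightarrow> b \<in> B \<Longrightarrow> \<not> E b a"
  unfolding joined_def completely_dominates_def by blast

lemma two_le_length_vcycle: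
  assumes "irreflp E" and "vcycle E xs"
  shows "2 \<le> length xs"
proof -
  have "length xs \<noteq> 1" using assms by (auto simp: vcycle_def length_Suc_conv irreflp_def)
  moreover have "length xs \<noteq> 0" using assms by (simp add: vcycle_def)
  ultimately show ?thesis by linarith
qed

text \<open>For joined sets, failure of domination one way is the existence of an arc the other way,
  so there are arcs in both directions and the two cycles can be merged.\<close>

lemma vcycle_two_parts:
  assumes irr: "irreflp E" and xs: "vcycle E xs" and ys: "vcycle E ys"
    and "set xs \<inter> set ys = {}" and j: "joined E (set xs) (set ys)"
    and "\<not> completely_dominates E (set xs) (set ys)" and "\<not> completely_dominates E (set ys) (set xs)"
  shows "\<exists>zs. vcycle E zs \<and> set zs = set xs \<union> set ys"
proof -
  obtain x where x: "cyclic_enum E (length xs) x" "range x = set xs"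
    using obtain_cyclic_enum[OF xs] .
  obtain y where y: "cyclic_enum E (length ys) y" "range y = set ys"
    using obtain_cyclic_enum[OF ys] .
  have "\<exists>a\<in>range x. \<exists>b\<in>range y. E a b" "\<exists>a\<in>range x. \<exists>b\<in>range y. E b a"
    using assms unfolding completely_dominates_def joined_def x y by blast+
  then have "\<exists>i j. E (x i) (y j)" "\<exists>i j. E (y j) (x i)" by blast+
  then show ?thesis
    using merge_two_cycles[OF x(1) y(1)] two_le_length_vcycle[OF irr] assms
    unfolding x y by blast
qed

lemma vcycle_three_parts:
  assumes "vcycle E xs" "vcycle E ys" "vcycle E zs"
    and "set xs \<inter> set ys = {}" "set xs \<inter> set zs = {}" "set ys \<inter> set zs = {}"
    and "completely_dominates E (set xs) (set ys)" "completely_dominates E (set ys) (set zs)" "completely_dominates E (set zs) (set xs)"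
  shows "vcycle E (xs @ ys @ zs)"
  using assms unfolding vcycle_def completely_dominates_def
  by (auto simp: successively_append_iff)

text \<open>Being joined and being disjoint pass to unions, so the merged part relates properly to
  the others. The count drops because at least two parts become one.\<close>

lemma ham_partition_merge:
  assumes F: "ham_partition E F U" and G: "G \<subseteq> F" "2 \<le> card G"
    and zs: "vcycle E zs" "set zs = \<Union>G"
  shows "ham_partition E (insert (\<Union>G) (F - G)) U"
    and "card (insert (\<Union>G) (F - G)) < card F"
proof -
  have fin: "finite F" using F by (simp add: ham_partition_def)
  have sep: "joined E (\<Union>G) B \<and> joined E B (\<Union>G) \<and> \<Union>G \<inter> B = {}" if "B \<in> F - G" for B
  proof -
    have AB: "joined E A B" "A \<inter> B = {}" if "A \<in> G" for A
    proof -
      have "A \<in> F" "B \<in> F" "A \<noteq> B" using G(1) \<open>B \<in> F - G\<close> that by auto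
      then show "joined E A B" "A \<inter> B = {}" using F unfolding ham_partition_def by metis+
    qed
    have "joined E (\<Union>G) B" unfolding joined_Union_iff using AB(1) by simp
    moreover have "\<Union>G \<inter> B = {}" using AB(2) by auto
    ultimately show ?thesis by (simp add: joined_sym)
  qed
  show "ham_partition E (insert (\<Union>G) (F - G)) U"
    unfolding ham_partition_def
  proof (intro conjI ballI impI)
    have "\<Union>F = U" using F by (simp add: ham_partition_def)
    then show "\<Union>(insert (\<Union>G) (F - G)) = U" using G(1) by blast
  next
    fix A assume A: "A \<in> insert (\<Union>G) (F - G)"
    show "\<exists>xs. vcycle E xs \<and> set xs = A"
    proof (cases "A = \<Union>G")
      case False
      then show ?thesis using A F by (simp add: ham_partition_def)
    qed (use zs in blast)
    fix B assume B: "B \<in> insert (\<Union>G) (F - G)" "A \<noteq> B"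
    consider "A = \<Union>G" "B \<in> F - G" | "B = \<Union>G" "A \<in> F - G" | "A \<in> F" "B \<in> F"
      using A B by blast
    then have "A \<inter> B = {} \<and> joined E A B"
    proof cases
      case 3
      then show ?thesis using F B(2) unfolding ham_partition_def by metis
    qed (use sep in auto)
    then show "A \<inter> B = {}" "joined E A B" by auto
  qed (simp add: fin)
  have "card (insert (\<Union>G) (F - G)) \<le> Suc (card (F - G))" by (rule card_insert_le_m1) auto
  also have "card (F - G) = card F - card G"
    using G fin by (meson card_Diff_subset finite_subset)
  also have "Suc (card F - card G) < card F"
    using G fin card_mono[OF fin G(1)] by linarith
  finally show "card (insert (\<Union>G) (F - G)) < card F" .
qed

text \<open>Insertion sort: the elements related to the new one precede it, the others follow.
  Transitivity is asked of three different elements only, the form in which merging three parts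
  provides it.\<close>

lemma sorted_wrt_list_of_set_exists:
  assumes "finite F"
    and "\<And>A B. A \<in> F \<Longrightarrow> B \<in> F \<Longrightarrow> A \<noteq> B \<Longrightarrow> R A B \<or> R B A"
    and "\<And>A B C. A \<in> F \<Longrightarrow> B \<in> F \<Longrightarrow> C \<in> F \<Longrightarrow> distinct [A, B, C] \<Longrightarrow> R A B \<Longrightarrow> R B C \<Longrightarrow> R A C"
  shows "\<exists>As. set As = F \<and> distinct As \<and> sorted_wrt R As"
  using assms
proof (induction F rule: finite_induct)
  case (insert A F)
  have "\<exists>As. set As = F \<and> distinct As \<and> sorted_wrt R As"
  proof (rule insert.IH, goal_cases)
    case (1 B C)
    then show ?case using insert.prems(1)[of B C] by simp
  next
    case (2 B C D)
    then show ?case using insert.prems(2)[of B C D] by simp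
  qed
  then obtain As where As: "set As = F" "distinct As" "sorted_wrt R As"
    by blast
  let ?As = "filter (\<lambda>B. R B A) As @ A # filter (\<lambda>B. \<not> R B A) As"
  have "R A B" if "B \<in> F" "\<not> R B A" for B
    using insert.prems(1)[of A B] insert.hyps(2) that by auto
  moreover have "R B C" if "B \<in> F" "C \<in> F" "R B A" "\<not> R C A" for B C
  proof (rule insert.prems(2)[of B A C])
    show "R A C" using calculation that by blast
    show "distinct [B, A, C]" using that insert.hyps(2) by auto
  qed (use that in auto)
  ultimately have "sorted_wrt R ?As"
    using As by (auto simp: sorted_wrt_append intro: sorted_wrt_filter)
  moreover have "set ?As = insert A F" "distinct ?As" using As insert.hyps by auto
  ultimately show ?case by blast
qed simp

text \<open>A partition with the least number of parts admits no merge. Two parts of which neither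
  dominates the other, or three in a cyclic pattern, would allow one.\<close>

lemma ham_partition_chain:
  assumes irr: "irreflp E" and "ham_partition E F U"
  shows "\<exists>As. distinct As \<and> sorted_wrt (completely_dominates E) As \<and> ham_partition E (set As) U"
proof -
  obtain F' where F': "ham_partition E F' U"
    and min: "\<And>F''. ham_partition E F'' U \<Longrightarrow> card F' \<le> card F''"
    using ex_has_least_nat[of "\<lambda>F. ham_partition E F U" F card] assms(2) by blast
  have no_merge: False if "G \<subseteq> F'" "2 \<le> card G" "vcycle E zs" "set zs = \<Union>G" for G zs
    using ham_partition_merge[OF F' that] min by fastforce
  have cyc: "\<exists>xs. vcycle E xs \<and> set xs = A" if "A \<in> F'" for A
    using F' that unfolding ham_partition_def by blast
  have sep: "A \<inter> B = {}" "joined E A B" if "A \<in> F'" "B \<in> F'" "A \<noteq> B" for A B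
    using F' that unfolding ham_partition_def by blast+
  have total: "completely_dominates E A B \<or> completely_dominates E B A" if AB: "A \<in> F'" "B \<in> F'" "A \<noteq> B" for A B
  proof (rule ccontr)
    assume *: "\<not> ?thesis"
    obtain xs ys where "vcycle E xs" "set xs = A" "vcycle E ys" "set ys = B"
      using cyc AB by metis
    then obtain zs where "vcycle E zs" "set zs = \<Union>{A, B}"
      using vcycle_two_parts[OF irr, of xs ys] sep[OF AB] * by auto
    moreover have "card {A, B} = 2" using AB by simp
    ultimately show False using no_merge[of "{A, B}" zs] AB by simp
  qed
  have trans: "completely_dominates E A C"
    if ABC: "A \<in> F'" "B \<in> F'" "C \<in> F'" "distinct [A, B, C]" "completely_dominates E A B" "completely_dominates E B C" for A B C
  proof (rule ccontr)
    assume "\<not> ?thesis"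
    then have CA: "completely_dominates E C A" using total ABC by auto
    obtain xs ys zs where "vcycle E xs" "set xs = A" "vcycle E ys" "set ys = B" "vcycle E zs" "set zs = C"
      using cyc ABC by metis
    then have "vcycle E (xs @ ys @ zs)" "set (xs @ ys @ zs) = \<Union>{A, B, C}"
      using vcycle_three_parts[of E xs ys zs] sep ABC CA by auto
    moreover have "card {A, B, C} = 3" using ABC by simp
    ultimately show False using no_merge[of "{A, B, C}" "xs @ ys @ zs"] ABC by simp
  qed
  have "finite F'" using F' by (simp add: ham_partition_def)
  then have "\<exists>As. set As = F' \<and> distinct As \<and> sorted_wrt (completely_dominates E) As"
    by (rule sorted_wrt_list_of_set_exists) (use total trans in blast)+
  then show ?thesis using F' by blast
qed

lemma strong_ham_partition_hamiltonian:
  assumes irr: "irreflp E" and "ham_partition E F V" and "strong_on E V" and "V \<noteq> {}"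
  shows "\<exists>xs. vcycle E xs \<and> set xs = V"
proof -
  obtain As where As: "sorted_wrt (completely_dominates E) As" "distinct As" "ham_partition E (set As) V"
    using ham_partition_chain[OF assms(1,2)] by blast
  show ?thesis
  proof (cases As)
    case Nil
    then show ?thesis using As(3) \<open>V \<noteq> {}\<close> by (simp add: ham_partition_def)
  next
    case (Cons A Bs)
    show ?thesis
    proof (cases Bs)
      case Nil
      then show ?thesis using As(3) Cons unfolding ham_partition_def by auto
    next
      case (Cons B Cs)
      have AB: "A \<in> set As" "B \<in> set As" "A \<noteq> B" using As \<open>As = A # Bs\<close> Cons by auto
      have V: "V = \<Union>(set As)" using As(3) by (simp add: ham_partition_def)
      have sep: "A \<inter> C = {}" "joined E A C" if "C \<in> set As" "C \<noteq> A" for C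
        using As(3) AB(1) that unfolding ham_partition_def by metis+
      have ne: "C \<noteq> {}" if "C \<in> set As" for C
      proof -
        have "\<exists>xs. vcycle E xs \<and> set xs = C"
          using As(3) that by (simp add: ham_partition_def)
        then obtain xs where xs: "vcycle E xs" "set xs = C" by blast
        have "xs \<noteq> []" using xs(1) by (simp add: vcycle_def)
        then show ?thesis using xs(2) by (metis set_empty)
      qed
      have "A \<subseteq> V" "B \<subseteq> V" unfolding V using Union_upper AB(1,2) by metis+
      moreover have "A \<inter> B = {}" "A \<noteq> {}" "B \<noteq> {}"
        using sep(1)[of B] ne[of A] ne[of B] AB by simp_all
      \<comment> \<open>Strength is applied to the complement of the first part \<open>A\<close>. An
        arc leaving it enters \<open>A\<close> from a part that \<open>A\<close> dominates, which is
        impossible.\<close>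
      ultimately have "V - A \<noteq> {}" "V - A \<noteq> V" by blast+
      then have "\<exists>b\<in>V - A. \<exists>a\<in>V - (V - A). E b a"
        using assms(3) unfolding strong_on_def by (elim allE[of _ "V - A"]) auto
      then obtain b a where ba: "b \<in> V - A" "a \<in> V - (V - A)" "E b a" by blast
      then obtain C where C: "C \<in> set As" "b \<in> C" "C \<noteq> A"
        unfolding V by blast
      then have "completely_dominates E A C" using As(1) \<open>As = A # Bs\<close> by auto
      moreover have "a \<in> A" using ba by blast
      ultimately show ?thesis
        using completely_dominates_asym[OF sep(2)[OF C(1,3)]] C(2) ba(3) by blast
    qed
  qed
qed

section \<open>Short cycles\<close>

lemma successively_take: "successively P xs \<Longrightarrow> successively P (take k xs)"
  by (simp add: successively_conv_nth)

lemma successively_drop: "successively P xs \<Longrightarrow> successively P (drop k xs)"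
  by (simp add: successively_conv_nth)

text \<open>The path is an initial segment of \<open>X\<close> rotated to begin at \<open>x\<close>,
  an initial segment of \<open>M\<close>, and a final segment of \<open>Z\<close> rotated to end at
  \<open>z\<close>. Domination supplies the connecting arcs, also from \<open>X\<close> straight to
  \<open>Z\<close> when \<open>M\<close> is skipped.\<close>

lemma path_through_chain:
  assumes X: "vcycle E X" and Z: "vcycle E Z" and M: "distinct M" "successively E M"
    and disj: "set X \<inter> set M = {}" "set X \<inter> set Z = {}" "set M \<inter> set Z = {}"
    and dom: "completely_dominates E (set X) (set M)" "completely_dominates E (set X) (set Z)" "completely_dominates E (set M) (set Z)"
    and x: "x \<in> set X" and z: "z \<in> set Z"
    and a: "2 \<le> a" "a \<le> length X + length M + length Z"
  shows "\<exists>p. distinct p \<and> successively E p \<and> p \<noteq> [] \<and> hd p = x \<and> last p = z \<and>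
    length p = a \<and> set p \<subseteq> set X \<union> set M \<union> set Z"
proof -
  obtain X' where X': "vcycle E X'" "set X' = set X" "length X' = length X" "hd X' = x"
    using vcycle_rotate_hd[OF X x] .
  obtain Z' where Z': "vcycle E Z'" "set Z' = set Z" "length Z' = length Z" "last Z' = z"
    using vcycle_rotate_last[OF Z z] .
  \<comment> \<open>Vertices are taken greedily from \<open>X\<close> and then from
    \<open>M\<close>, with one always reserved for \<open>Z\<close>; \<open>e\<close> counts the
    vertices dropped at the front of \<open>Z'\<close>.\<close>
  define b where "b = min (a - 1) (length X)"
  define c where "c = min (a - 1 - b) (length M)"
  define e where "e = length Z - (a - b - c)"
  have nonempty: "X' \<noteq> []" "Z' \<noteq> []" using X' Z' by (auto simp: vcycle_def)
  then have pos: "0 < length X" "0 < length Z" using X' Z' by (metis length_greater_0_conv)+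
  have "1 \<le> b" "b \<le> length X" "b \<le> a - 1" using a pos by (auto simp: b_def Suc_le_eq)
  moreover have "c \<le> length M" "c \<le> a - 1 - b" by (auto simp: c_def)
  moreover have "a - b - c \<le> length Z" using a pos by (auto simp: b_def c_def min_def Suc_le_eq)
  ultimately have bc: "1 \<le> b" "b \<le> length X" "c \<le> length M" "e < length Z" "b + c + (length Z - e) = a"
    using a pos by (auto simp: e_def)
  let ?A = "take b X'" and ?B = "take c M" and ?C = "drop e Z'"
  have sub: "set ?A \<subseteq> set X" "set ?B \<subseteq> set M" "set ?C \<subseteq> set Z"
    using X' Z' set_take_subset[of b X'] set_take_subset[of c M] set_drop_subset[of e Z'] by auto
  have ne: "?A \<noteq> []" "?C \<noteq> []" using bc nonempty Z' by auto
  have "distinct (?A @ ?B @ ?C)"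
    using X'(1) Z'(1) M(1) sub disj unfolding vcycle_def by (auto simp: disjoint_iff)
  moreover have "successively E (?A @ ?B @ ?C)"
  proof -
    have A: "last ?A \<in> set X" and C: "hd ?C \<in> set Z"
      using sub(1,3) last_in_set[OF ne(1)] hd_in_set[OF ne(2)] by (simp_all add: subset_iff)
    have B: "hd ?B \<in> set M" "last ?B \<in> set M" if "?B \<noteq> []"
      using sub(2) last_in_set[OF that] hd_in_set[OF that] by (simp_all add: subset_iff)
    have "E (last ?A) (hd ?C)" using dom(2) A C by (simp add: completely_dominates_def)
    moreover have "E (last ?A) (hd ?B)" "E (last ?B) (hd ?C)" if "?B \<noteq> []"
      using dom(1,3) A B[OF that] C by (simp_all add: completely_dominates_def)
    moreover have "successively E ?A" "successively E ?B" "successively E ?C"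
      using X'(1) Z'(1) M(2) by (simp_all add: vcycle_def successively_take successively_drop)
    ultimately show ?thesis
      unfolding successively_append_iff by (cases "?B = []") (simp_all del: take_eq_Nil)
  qed
  moreover have "hd (?A @ ?B @ ?C) = x" "last (?A @ ?B @ ?C) = z"
    using ne X' Z' bc by auto
  moreover have "length (?A @ ?B @ ?C) = a" using bc X' Z' by simp
  ultimately show ?thesis using ne sub by (intro exI[of _ "?A @ ?B @ ?C"]) auto
qed

text \<open>Take a shortest segment of \<open>y\<close>, with \<open>q\<close> arcs, from an
  out-neighbour of \<open>z\<close> to an in-neighbour of \<open>x\<close>. Lengths up to
  \<open>q + 2\<close> come from an initial piece of it closed by \<open>z\<close> alone, larger
  ones from the whole segment followed by a path from \<open>x\<close> to \<open>z\<close>.\<close>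

lemma short_cycles_through_chain:
  assumes X: "vcycle E X" and Z: "vcycle E Z" and M: "distinct M" "successively E M"
    and disj: "set X \<inter> set M = {}" "set X \<inter> set Z = {}" "set M \<inter> set Z = {}"
    and dom: "completely_dominates E (set X) (set M)" "completely_dominates E (set X) (set Z)" "completely_dominates E (set M) (set Z)"
    and y: "cyclic_enum E m y" and ydisj: "range y \<inter> (set X \<union> set M \<union> set Z) = {}"
    and join: "joined E (range y) (set Z)"
    and out: "\<exists>j. \<exists>v\<in>set X. E (y j) v" and "in": "\<exists>j. \<exists>v\<in>set Z. E v (y j)"
    and l: "3 \<le> l" "l \<le> length X + length M + length Z + 1"
  shows "\<exists>zs. vcycle E zs \<and> length zs = l"
proof -
  txt \<open>Minimality of $q$ below forces every $y_t$ with $h < t \le h + q$ to have no in-neighbour in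
    $Z$, hence to dominate $Z$.\<close>
  define P where "P q \<longleftrightarrow> (\<exists>h. (\<exists>v\<in>set Z. E v (y h)) \<and> (\<exists>v\<in>set X. E (y (h + q)) v))" for q
  have m: "0 < m" and per: "\<And>j. y (j + m) = y j" using y by (auto simp: cyclic_enum_def)
  obtain h j where "\<exists>v\<in>set Z. E v (y h)" "\<exists>v\<in>set X. E (y j) v" using out "in" by blast
  \<comment> \<open>Adding \<open>h\<close> full turns to \<open>j\<close> makes the index at least
    \<open>h\<close>, so the subtraction is exact and some number satisfies
    \<open>P\<close>.\<close>
  moreover have "h + (j + h * m - h) = j + h * m" using m by (cases m) auto
  then have "y (h + (j + h * m - h)) = y j" using periodic_mult[of y m, OF per] by simp
  ultimately have "P (j + h * m - h)" unfolding P_def by metis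
  then obtain q where q: "P q" and min: "\<And>r. r < q \<Longrightarrow> \<not> P r"
    using exists_least_iff[of P] by blast
  obtain h x z where h: "z \<in> set Z" "E z (y h)" "x \<in> set X" "E (y (h + q)) x"
    using q unfolding P_def by blast
  have path: "\<exists>p. distinct p \<and> successively E p \<and> p \<noteq> [] \<and> hd p = x \<and> last p = z \<and>
    length p = a \<and> set p \<subseteq> set X \<union> set M \<union> set Z"
    if "2 \<le> a" "a \<le> length X + length M + length Z" for a
    using path_through_chain[OF X Z M disj dom h(3,1) that] .
  \<comment> \<open>A full turn could be removed from a longer segment. The bound makes the vertices
    of the segment distinct.\<close>
  have "q < m"
  proof (rule ccontr)
    assume "\<not> q < m"
    then have "y (h + (q - m)) = y (h + q)" using per[of "h + (q - m)"] by (simp add: add.assoc)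
    then have "P (q - m)" using h unfolding P_def by metis
    then show False using min[of "q - m"] m \<open>\<not> q < m\<close> by simp
  qed
  show ?thesis
  proof (cases "l \<le> q + 2")
    case True
    define s where "s = l - 2"
    have s: "1 \<le> s" "s \<le> q" "l = s + 2" using True l by (auto simp: s_def)
    have "\<not> E z (y (h + s))"
    proof
      assume "E z (y (h + s))"
      then have "P (q - s)" unfolding P_def using h s
        by (intro exI[of _ "h + s"]) auto
      then show False using min[of "q - s"] s by simp
    qed
    then have "E (y (h + s)) z" using join h(1) unfolding joined_def by blast
    then have "vcycle E (map y [h..<h + Suc s] @ [z])"
      unfolding vcycle_def
      using h s \<open>q < m\<close> ydisj successively_cyclic_enum[OF y] distinct_cyclic_enum[OF y]
      by (auto simp: successively_append_iff last_map_upt hd_map_upt disjoint_iff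
          simp del: successively_map upt_Suc map_append)
    then show ?thesis using s by (intro exI[of _ "map y [h..<h + Suc s] @ [z]"]) simp
  next
    case False
    \<comment> \<open>The segment contributes \<open>Suc q\<close> vertices; the path from
      \<open>x\<close> to \<open>z\<close> must supply the rest, at least two in this case.\<close>
    define a where "a = l - Suc q"
    have a: "2 \<le> a" "a \<le> length X + length M + length Z" "l = Suc q + a"
      using False l by (auto simp: a_def)
    obtain p where p: "distinct p" "successively E p" "p \<noteq> []" "hd p = x" "last p = z"
      "length p = a" "set p \<subseteq> set X \<union> set M \<union> set Z"
      using path a by blast
    then have "vcycle E (map y [h..<h + Suc q] @ p)"
      unfolding vcycle_def
      using h \<open>q < m\<close> ydisj successively_cyclic_enum[OF y] distinct_cyclic_enum[OF y]
      by (auto simp: successively_append_iff last_map_upt hd_map_upt disjoint_iff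
          simp del: successively_map upt_Suc map_append)
    then show ?thesis using a p by (intro exI[of _ "map y [h..<h + Suc q] @ p"]) simp
  qed
qed

text \<open>The cycle of the first part is opened anywhere and followed by a path through the later
  parts. The list may be a portion of a chain, so cycles and disjointness are drawn from the larger
  \<open>F\<close>.\<close>

lemma hamiltonian_path_of_chain:
  assumes "distinct As" and "sorted_wrt (completely_dominates E) As" and "ham_partition E F U" and "set As \<subseteq> F"
  shows "\<exists>M. distinct M \<and> successively E M \<and> set M = \<Union>(set As)"
  using assms(1,2,4)
proof (induction As)
  case (Cons A As)
  then obtain M where M: "distinct M" "successively E M" "set M = \<Union>(set As)" by auto
  obtain xs where xs: "vcycle E xs" "set xs = A"
    using Cons.prems assms(3) unfolding ham_partition_def by (meson list.set_intros(1) subsetD)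
  have "A \<inter> B = {}" if "B \<in> set As" for B
  proof -
    have "A \<in> F" "B \<in> F" "A \<noteq> B" using Cons.prems that by auto
    then show ?thesis using assms(3) unfolding ham_partition_def by metis
  qed
  then have "A \<inter> set M = {}" using M by blast
  moreover have "E (last xs) (hd M)" if "M \<noteq> []"
  proof -
    have "last xs \<in> A" using xs by (auto simp: vcycle_def)
    moreover have "hd M \<in> \<Union>(set As)" using M(3) that by (metis hd_in_set)
    ultimately show ?thesis using Cons.prems unfolding completely_dominates_def by auto
  qed
  ultimately show ?case using M xs
    by (intro exI[of _ "xs @ M"]) (auto simp: vcycle_def successively_append_iff)
qed (intro exI[of _ "[]"], simp)

lemma short_cycles_of_ham_partition:
  assumes irr: "irreflp E" and F: "ham_partition E F U" and Y: "vcycle E Y"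
    and disj: "U \<inter> set Y = {}" and join: "joined E U (set Y)"
    and strong: "strong_on E (U \<union> set Y)" and "U \<noteq> {}"
    and l: "3 \<le> l" "l \<le> card U + 1"
  shows "\<exists>zs. vcycle E zs \<and> length zs = l"
proof -
  obtain As where As: "sorted_wrt (completely_dominates E) As" "distinct As" "ham_partition E (set As) U"
    using ham_partition_chain[OF irr F] by blast
  have cyc: "\<exists>xs. vcycle E xs \<and> set xs = A" if "A \<in> set As" for A
    using As(3) that unfolding ham_partition_def by blast
  have sep: "A \<inter> B = {}" "joined E A B" if "A \<in> set As" "B \<in> set As" "A \<noteq> B" for A B
    using As(3) that unfolding ham_partition_def by blast+
  have U: "U = \<Union>(set As)" using As(3) by (simp add: ham_partition_def)
  obtain y where y: "cyclic_enum E (length Y) y" "range y = set Y" using obtain_cyclic_enum[OF Y] .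
  have Yne: "set Y \<noteq> {}" using Y by (simp add: vcycle_def)
  have exits: "\<exists>a\<in>W. \<exists>b\<in>U \<union> set Y - W. E a b" if "W \<subseteq> U \<union> set Y" "W \<noteq> {}" "W \<noteq> U \<union> set Y" for W
    using strong that unfolding strong_on_def by blast
  show ?thesis
  proof (cases As)
    case Nil
    then show ?thesis using U \<open>U \<noteq> {}\<close> by simp
  next
    case (Cons A Bs)
    obtain X where X: "vcycle E X" "set X = A" using cyc[of A] Cons by auto
    show ?thesis
    proof (cases Bs rule: rev_cases)
      case Nil
      then have "U = set X" using U Cons X by simp
      obtain x where x: "cyclic_enum E (length X) x" "range x = set X"
        using obtain_cyclic_enum[OF X(1)] .
      \<comment> \<open>With a single part, the cuts at \<open>U\<close> and at \<open>set Y\<close>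
        give arcs in both directions between the two cycles.\<close>
      have "\<exists>a\<in>U. \<exists>b\<in>set Y. E a b" "\<exists>b\<in>set Y. \<exists>a\<in>U. E b a"
        using exits[of U] exits[of "set Y"] \<open>U \<noteq> {}\<close> Yne disj by blast+
      then have arcs: "\<exists>i j. E (x i) (y j)" "\<exists>i j. E (y j) (x i)"
        unfolding \<open>U = set X\<close> x(2)[symmetric] y(2)[symmetric] by blast+
      have len: "2 \<le> length X" "2 \<le> length Y" using two_le_length_vcycle[OF irr] X(1) Y by blast+
      have xy: "range x \<inter> range y = {}" "joined E (range x) (range y)"
        using disj join unfolding x(2) y(2) \<open>U = set X\<close> by blast+
      have "length X = card U"
        using X(1) unfolding \<open>U = set X\<close> by (simp add: vcycle_def distinct_card)
      then have "l \<le> length X + 1" using l by simp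
      then show ?thesis by (rule short_cycles_of_two_cycles[OF x(1) y(1) len xy arcs l(1)])
    next
      case (snoc Ms C)
      then have As_eq: "As = A # Ms @ [C]" using Cons by simp
      obtain Z where Z: "vcycle E Z" "set Z = C" using cyc[of C] As_eq by auto
      \<comment> \<open>If there are only two parts, then \<open>Ms\<close> and the path
        \<open>M\<close> are empty.\<close>
      obtain M where M: "distinct M" "successively E M" "set M = \<Union>(set Ms)"
        using hamiltonian_path_of_chain[of Ms E "set As" U] As unfolding As_eq
        by (auto simp: sorted_wrt_append)
      have dist: "A \<noteq> C" "A \<notin> set Ms" "C \<notin> set Ms" using As(2) unfolding As_eq by auto
      have dom: "completely_dominates E A (set M)" "completely_dominates E A C" "completely_dominates E (set M) C"
        using As(1) unfolding As_eq M(3) completely_dominates_def by (auto simp: sorted_wrt_append)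
      have sets: "A \<inter> set M = {}" "A \<inter> C = {}" "set M \<inter> C = {}"
      proof -
        have "A \<inter> B = {} \<and> B \<inter> C = {}" if "B \<in> set Ms" for B
          using sep(1)[of A B] sep(1)[of B C] that dist unfolding As_eq by auto
        then show "A \<inter> set M = {}" "set M \<inter> C = {}" unfolding M(3) by blast+
        show "A \<inter> C = {}" using sep(1)[of A C] dist unfolding As_eq by simp
      qed
      have joins: "joined E A (set M)" "joined E A C" "joined E (set M) C"
      proof -
        have "joined E A B \<and> joined E B C" if "B \<in> set Ms" for B
          using sep(2)[of A B] sep(2)[of B C] that dist unfolding As_eq by auto
        then show "joined E A (set M)" "joined E (set M) C" unfolding M(3) joined_def by blast+
        show "joined E A C" using sep(2)[of A C] dist unfolding As_eq by simp
      qed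
      have U_eq: "U = A \<union> set M \<union> C" unfolding U As_eq M(3) by auto
      have ne: "A \<noteq> {}" "C \<noteq> {}" using X Z by (auto simp: vcycle_def)
      \<comment> \<open>Some arc enters the first part. It cannot come from the parts dominated by
        \<open>A\<close>, so it comes from \<open>Y\<close>; dually, an arc leaving the last part
        \<open>C\<close> ends in \<open>Y\<close>.\<close>
      have "\<exists>b\<in>set M \<union> C \<union> set Y. \<exists>a\<in>A. E b a"
        using exits[of "set M \<union> C \<union> set Y"] ne sets disj unfolding U_eq by blast
      then have out: "\<exists>b\<in>set Y. \<exists>a\<in>A. E b a"
        using completely_dominates_asym[OF joins(1) dom(1)]
          completely_dominates_asym[OF joins(2) dom(2)] by blast
      have "\<exists>c\<in>C. \<exists>b\<in>A \<union> set M \<union> set Y. E c b"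
        using exits[of C] ne sets disj unfolding U_eq by blast
      then have "in": "\<exists>c\<in>C. \<exists>b\<in>set Y. E c b"
        using completely_dominates_asym[OF joins(2) dom(2)]
          completely_dominates_asym[OF joins(3) dom(3)] by blast
      have "card U = length X + length M + length Z"
      proof -
        have "distinct (X @ M @ Z)" using X Z M(1) sets by (auto simp: vcycle_def)
        moreover have "U = set (X @ M @ Z)" unfolding U_eq using X(2) Z(2) by auto
        ultimately show ?thesis using distinct_card[of "X @ M @ Z"] by simp
      qed
      then have l': "l \<le> length X + length M + length Z + 1" using l by simp
      have "joined E (range y) C" using join unfolding U_eq y(2) joined_def by blast
      moreover have "range y \<inter> (A \<union> set M \<union> C) = {}" using disj unfolding U_eq y(2) by blast
      moreover have "\<exists>j. \<exists>v\<in>A. E (y j) v" using out unfolding y(2)[symmetric] by blast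
      moreover have "\<exists>j. \<exists>v\<in>C. E v (y j)" using "in" unfolding y(2)[symmetric] by blast
      ultimately show ?thesis
        using short_cycles_through_chain[OF X(1) Z(1) M(1,2), unfolded X(2) Z(2),
            OF sets dom y(1) _ _ _ _ l(1) l'] by blast
    qed
  qed
qed

section \<open>Cycles of pair digraphs\<close>

text \<open>The list is closed by its first vertex and turned into arcs. The tails of these arcs are
  again the list, which gives the length and the vertex set.\<close>

lemma vcycle_imp_cycle:
  assumes D: "pair_wf_digraph D" and xs: "vcycle (\<lambda>u v. (u, v) \<in> parcs D) xs"
  shows "\<exists>p. pre_digraph.cycle (with_proj D) p \<and> length p = length xs \<and>
    cycle_verts (with_proj D) p = set xs"
proof -
  interpret pair_wf_digraph D by (rule D)
  have ends: "pcas (hd ws) (vwalk_arcs ws) (last ws)" "pawalk_verts (hd ws) (vwalk_arcs ws) = ws"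
    "map fst (vwalk_arcs ws) = butlast ws" if "ws \<noteq> []" for ws :: "'a list"
    using that by (induction ws rule: vwalk_arcs.induct) auto
  have arcs: "set (vwalk_arcs ws) \<subseteq> parcs D" if "successively (\<lambda>u v. (u, v) \<in> parcs D) ws" for ws
    using that by (induction ws rule: vwalk_arcs.induct) auto
  let ?ws = "xs @ [hd xs]" let ?p = "vwalk_arcs ?ws"
  have "xs \<noteq> []" using xs by (simp add: vcycle_def)
  then have hd: "hd ?ws = hd xs" by simp
  have sub: "set ?p \<subseteq> parcs D"
    by (rule arcs) (use xs in \<open>auto simp: vcycle_def successively_append_iff\<close>)
  have fst: "map fst ?p = xs" using ends(3)[of ?ws] by simp
  then have "?p \<noteq> []" using \<open>xs \<noteq> []\<close> by auto
  moreover have "hd xs \<in> pverts D"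
  proof -
    have "hd xs = fst (hd ?p)" using \<open>?p \<noteq> []\<close> fst by (metis hd_map)
    moreover have "hd ?p \<in> parcs D" using \<open>?p \<noteq> []\<close> sub by (meson hd_in_set subsetD)
    ultimately show ?thesis using arc_fst_in_verts by metis
  qed
  moreover have "distinct (tl ?ws)"
    using xs by (cases xs) (auto simp: vcycle_def)
  ultimately have "cycle ?p"
    unfolding cycle_def awalk_def using ends(1,2)[of ?ws] sub hd by (intro exI[of _ "hd xs"]) simp
  moreover have "length ?p = length xs" using arg_cong[OF fst, of length] by simp
  moreover have "cycle_verts (with_proj D) ?p = set xs"
    using arg_cong[OF fst, of set] by (simp add: cycle_verts_def)
  ultimately show ?thesis by blast
qed

text \<open>The list of tails serves. The definition of a cycle makes the heads distinct, and in a
  closed walk heads and tails agree as multisets.\<close>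

lemma cycle_imp_vcycle:
  assumes D: "pair_wf_digraph D" and p: "pre_digraph.cycle (with_proj D) p"
  shows "\<exists>xs. vcycle (\<lambda>u v. (u, v) \<in> parcs D) xs \<and> set xs = cycle_verts (with_proj D) p \<and>
    set xs \<subseteq> pverts D"
proof -
  interpret pair_wf_digraph D by (rule D)
  obtain u where u: "awalk u p u" "distinct (tl (pawalk_verts u p))" "p \<noteq> []"
    using p unfolding cycle_def by auto
  then have sub: "set p \<subseteq> parcs D" and cas: "pcas u p u" unfolding awalk_def by auto
  \<comment> \<open>Both sides list the vertices of the walk from \<open>w\<close> to
    \<open>v\<close>.\<close>
  have fst_snd: "map fst q @ [v] = w # map snd q" if "pcas w q v" for w v and q :: "('a \<times> 'a) list"
    using that by (induction q arbitrary: w) auto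
  have succ: "successively (\<lambda>u v. (u, v) \<in> parcs D) (map fst q @ [v])"
    if "pcas w q v" "set q \<subseteq> parcs D" for w v q
    using that
  proof (induction q arbitrary: w)
    case (Cons e q)
    then show ?case by (cases q) auto
  qed simp
  have "pawalk_verts u p = map fst p @ [snd (last p)]"
    using awalk_verts_conv[of u p] u(3) by simp
  also have "snd (last p) = u" 
    using arg_cong[OF fst_snd[OF cas], of last] u(3) by (simp add: last_map)
  finally have "pawalk_verts u p = u # map snd p" using fst_snd[OF cas] by simp
  then have "distinct (map snd p)" using u(2) by simp
  moreover have "mset (map fst p) = mset (map snd p)"
    using arg_cong[OF fst_snd[OF cas], of mset] by simp
  ultimately have "distinct (map fst p)" by (metis mset_eq_imp_distinct_iff)
  moreover have "hd (map fst p) = u" using u(3) cas by (cases p) auto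
  ultimately have "vcycle (\<lambda>u v. (u, v) \<in> parcs D) (map fst p)"
    using succ[OF cas sub] u(3) unfolding vcycle_def by (simp add: successively_append_iff)
  then show ?thesis
    using sub in_arcsD1 by (intro exI[of _ "map fst p"]) (auto simp: cycle_verts_def)
qed

text \<open>If no arc left \<open>W\<close>, everything reachable from a vertex of \<open>W\<close>
  would stay in \<open>W\<close>.\<close>

lemma strong_on_pverts:
  assumes D: "pair_wf_digraph D" and strong: "strongly_connected (with_proj D)"
  shows "strong_on (\<lambda>u v. (u, v) \<in> parcs D) (pverts D)"
  unfolding strong_on_def
proof (intro allI impI)
  interpret pair_wf_digraph D by (rule D)
  fix W assume W: "W \<subseteq> pverts D" "W \<noteq> {}" "W \<noteq> pverts D"
  then obtain a b where ab: "a \<in> W" "b \<in> pverts D" "b \<notin> W" by blast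
  show "\<exists>a\<in>W. \<exists>b\<in>pverts D - W. (a, b) \<in> parcs D"
  proof (rule ccontr)
    assume *: "\<not> ?thesis"
    have "a \<rightarrow>\<^sup>*\<^bsub>with_proj D\<^esub> b"
      using strong ab W unfolding strongly_connected_def by auto
    then have "(a, b) \<in> (parcs D)\<^sup>*" using reachable_rtranclI by fastforce
    then have "b \<in> W"
      by (induction rule: rtrancl_induct) (use ab * in_arcsD2 in blast)+
    then show False using ab by blast
  qed
qed

section \<open>Application to the summands of a generalized sum\<close>

theorem theorem35:
  fixes k :: nat
    and Ds :: "nat \<Rightarrow> 'a pair_pre_digraph"
    and n :: "nat \<Rightarrow> nat"
    and D :: "'a pair_pre_digraph"
  assumes "k \<ge> 2"
    and "\<And>i. i \<in> {1..k} \<Longrightarrow> pair_digraph (Ds i)"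
    and "disjoint_family_on (\<lambda>i. pverts (Ds i)) {1..k}"
    and "\<And>i. i \<in> {1..k} \<Longrightarrow> hamiltonian (with_proj (Ds i))"
    and "\<And>i. i \<in> {1..k} \<Longrightarrow> n i = card (pverts (Ds i))"
    and "D \<in> generalized_sum k Ds"
    and "strongly_connected (with_proj D)"
  shows "vertex_pancyclic (with_proj D) \<or>
    pancyclic (with_proj D) \<or>
    (hamiltonian (with_proj D) \<and>
      (\<forall>l. 3 \<le> l \<and> l \<le> Max {(\<Sum>i\<in>S. n i) + 1 | S. S \<subset> {1..k} \<and> card S = k - 1}
         \<longrightarrow> has_cycle_of_length (with_proj D) l))"
proof -
  let ?V = "\<lambda>i. pverts (Ds i)"
  let ?E = "\<lambda>u v. (u, v) \<in> parcs D"
  have D: "pair_digraph D" and V: "pverts D = (\<Union>i\<in>{1..k}. ?V i)"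
    and ind: "\<forall>i\<in>{1..k}. induced_subgraph (with_proj (Ds i)) (with_proj D)"
    and adj: "\<forall>i\<in>{1..k}. \<forall>j\<in>{1..k}. i \<noteq> j \<longrightarrow>
      (\<forall>u\<in>?V i. \<forall>v\<in>?V j. ((u, v) \<in> parcs D) \<noteq> ((v, u) \<in> parcs D))"
  proof -
    note conj = assms(6)[unfolded generalized_sum_def mem_Collect_eq]
    show "pair_digraph D" by (rule conjunct1[OF conj])
    show "pverts D = (\<Union>i\<in>{1..k}. ?V i)" by (rule conjunct1[OF conjunct2[OF conj]])
    show "\<forall>i\<in>{1..k}. induced_subgraph (with_proj (Ds i)) (with_proj D)"
      by (rule conjunct1[OF conjunct2[OF conjunct2[OF conj]]])
    show "\<forall>i\<in>{1..k}. \<forall>j\<in>{1..k}. i \<noteq> j \<longrightarrow>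
      (\<forall>u\<in>?V i. \<forall>v\<in>?V j. ((u, v) \<in> parcs D) \<noteq> ((v, u) \<in> parcs D))"
      by (rule conjunct2[OF conjunct2[OF conjunct2[OF conj]]])
  qed
  have sub: "parcs (Ds i) \<subseteq> parcs D" if "i \<in> {1..k}" for i
    using bspec[OF ind that] by (auto simp: induced_subgraph_def)
  have wf: "pair_wf_digraph D" "\<And>i. i \<in> {1..k} \<Longrightarrow> pair_wf_digraph (Ds i)"
    using D assms(2) by (auto simp: pair_digraph_def pair_fin_digraph_def)
  have irr: "irreflp ?E"
    using pair_loopfree_digraph.pair_no_loops[of D] D by (fastforce simp: irreflp_def pair_digraph_def)
  have finD: "finite (pverts D)"
    using D by (simp add: pair_digraph_def pair_fin_digraph_def pair_fin_digraph_axioms_def)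
  have cyc: "\<exists>xs. vcycle ?E xs \<and> set xs = ?V i" if i: "i \<in> {1..k}" for i
  proof -
    obtain p where p: "pre_digraph.cycle (with_proj (Ds i)) p" "?V i \<subseteq> cycle_verts (with_proj (Ds i)) p"
      using assms(4)[OF i] by (auto simp: hamiltonian_def)
    then obtain xs where xs: "vcycle (\<lambda>u v. (u, v) \<in> parcs (Ds i)) xs" "set xs = ?V i"
      using cycle_imp_vcycle[OF wf(2)[OF i] p(1)] by blast
    then have "vcycle ?E xs"
      using sub[OF i] unfolding vcycle_def by (auto elim: successively_mono)
    with xs show ?thesis by blast
  qed
  have sep: "?V i \<inter> ?V j = {}" "joined ?E (?V i) (?V j)"
    if "i \<in> {1..k}" "j \<in> {1..k}" "i \<noteq> j" for i j
    using disjoint_family_onD[OF assms(3) that] bspec[OF bspec[OF adj that(1)] that(2)] that(3)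
    by (simp_all add: joined_def)
  have part: "ham_partition ?E (?V ` S) (\<Union>(?V ` S))" if "S \<subseteq> {1..k}" for S
    unfolding ham_partition_def
  proof (intro conjI ballI impI)
    show "finite (?V ` S)" using that finite_subset by blast
  next
    fix A assume "A \<in> ?V ` S"
    then show "\<exists>xs. vcycle ?E xs \<and> set xs = A" using cyc that by blast
  next
    fix A B assume AB: "A \<in> ?V ` S" "B \<in> ?V ` S" "A \<noteq> B"
    obtain i where i: "A = ?V i" "i \<in> S" using AB(1) by (rule imageE)
    obtain j where j: "B = ?V j" "j \<in> S" using AB(2) by (rule imageE)
    have ij: "i \<in> {1..k}" "j \<in> {1..k}" "i \<noteq> j" using i j AB(3) that by fast+
    show "A \<inter> B = {}" "joined ?E A B" unfolding i(1) j(1) by (rule sep[OF ij])+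
  qed simp
  have strong: "strong_on ?E (pverts D)" by (rule strong_on_pverts[OF wf(1) assms(7)])
  have "pverts D \<noteq> {}" using assms(7) by (simp add: strongly_connected_def)
  then obtain xs where "vcycle ?E xs" "set xs = pverts D"
    using strong_ham_partition_hamiltonian[OF irr part[of "{1..k}", folded V] strong] by auto
  then have ham: "hamiltonian (with_proj D)"
    using vcycle_imp_cycle[OF wf(1)] by (force simp: hamiltonian_def)
  let ?M = "{(\<Sum>i\<in>S. n i) + 1 | S. S \<subset> {1..k} \<and> card S = k - 1}"
  have "has_cycle_of_length (with_proj D) l" if l: "3 \<le> l" "l \<le> Max ?M" for l
  proof -
    have "finite ?M"
      by (rule finite_subset[of _ "(\<lambda>S. (\<Sum>i\<in>S. n i) + 1) ` Pow {1..k}"]) auto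
    \<comment> \<open>This index set shows that the maximum is taken over a nonempty set and is
      therefore attained.\<close>
    moreover have "{1..<k} \<subset> {1..k}" "card {1..<k} = k - 1" using assms(1) by auto
    then have "?M \<noteq> {}" by blast
    ultimately have "Max ?M \<in> ?M" by (rule Max_in)
    then obtain S where S: "S \<subset> {1..k}" "card S = k - 1" "Max ?M = (\<Sum>i\<in>S. n i) + 1" by blast
    then have finS: "finite S" using finite_subset by blast
    \<comment> \<open>The maximizing \<open>S\<close> omits exactly one summand \<open>m\<close>,
      whose cycle \<open>ys\<close> plays the part of \<open>Y\<close>, while the summands in
      \<open>S\<close> partition \<open>?U\<close>.\<close>
    have "card ({1..k} - S) = 1" using S finS assms(1) by (simp add: card_Diff_subset)
    then obtain m where m: "{1..k} - S = {m}" by (auto simp: card_1_singleton_iff)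
    then have mk: "m \<in> {1..k}" "m \<notin> S" "{1..k} = insert m S" using S by auto
    obtain ys where ys: "vcycle ?E ys" "set ys = ?V m" using cyc mk by blast
    let ?U = "\<Union>(?V ` S)"
    have "S \<noteq> {}" using S(2) assms(1) by auto
    then obtain i where "i \<in> S" by blast
    then have "?V i \<noteq> {}" using cyc[of i] S by (auto simp: vcycle_def)
    then have U: "?U \<noteq> {}" using \<open>i \<in> S\<close> by blast
    have sepm: "?V i \<inter> ?V m = {}" "joined ?E (?V i) (?V m)" if "i \<in> S" for i
    proof -
      have "i \<in> {1..k}" "i \<noteq> m" using that S(1) mk(2) by blast+
      then show "?V i \<inter> ?V m = {}" "joined ?E (?V i) (?V m)" using sep mk(1) by blast+
    qed
    have Uys: "?U \<inter> set ys = {}" "joined ?E ?U (set ys)"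
      unfolding ys(2) Int_UN_distrib2 joined_Union_iff using sepm by auto
    have "pverts D = ?U \<union> set ys" unfolding V mk(3) ys(2) by auto
    with strong have strongU: "strong_on ?E (?U \<union> set ys)" by simp
    have "card ?U = (\<Sum>i\<in>S. n i)"
    proof -
      have "finite (?V i)" if "i \<in> S" for i
        using that S(1) finD unfolding V by (meson UN_upper finite_subset psubsetD)
      then have "card ?U = (\<Sum>i\<in>S. card (?V i))"
        using S(1) sep(1) finS by (intro card_UN_disjoint) blast+
      also have "\<dots> = (\<Sum>i\<in>S. n i)" using assms(5) S(1) by (intro sum.cong) auto
      finally show ?thesis .
    qed
    then have "l \<le> card ?U + 1" using l S by simp
    moreover have "S \<subseteq> {1..k}" using S by blast
    ultimately have "\<exists>zs. vcycle ?E zs \<and> length zs = l"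
      using short_cycles_of_ham_partition[OF irr part ys(1) Uys strongU U l(1)] by blast
    then show ?thesis
      using vcycle_imp_cycle[OF wf(1)] unfolding has_cycle_of_length_def by blast
  qed
  with ham show ?thesis by blast
qed

end
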